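(* Let $h \geq 1$ and let $H$ be a connected graph on $h$ vertices containing a vertex $v$ such that $H \setminus v$ is a tree. Suppose there exist $c \geq 1$ and $0 < \alpha \leq 1$ such that $\mathrm{ex}(n,H) \leq c\, n^{1+\alpha}$ for all $n \geq 1$. Then for all $n \geq 1$, \[ \lambda(n,H) \leq 20 \cdot \frac{\sqrt{c h}}{\alpha} \cdot n^{\alpha/2}. \]
   Context: An orthonormal representation of a graph $G$ is a map $f: V(G) \to \mathbb{R}^d$ (some $d$) with $\|f(u)\|=1$ for all $u$ and $\langle f(u), f(v)\rangle = 0$ for all distinct non-adjacent $u,v$. For a graph $G$, $\vartheta(\overline{G})$ (the Lovász theta function of the complement of $G$) equals the maximum, over all orthonormal representations $f$ of $G$, of the largest eigenvalue of the Gram matrix $(\langle f(u), f(v)\rangle)_{u,v}$. A graph is $H$-free if it contains no (not necessarily induced) subgraph isomorphic to $H$. $\lambda(n,H)$ denotes the maximum of $\vartheta(\overline{G})$ over all $H$-free simple graphs $G$ on $n$ vertices. $\mathrm{ex}(n,H)$ is the Turán number: the maximum number of edges in an $H$-free graph on $n$ vertices. *)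

theory Defs
  imports
    Complex_Main
    "Jordan_Normal_Form.Spectral_Radius"
    "Graph_Theory.Graph_Theory"
begin

text \<open>
  A finite simple graph is a \<^locale>\<open>pair_graph\<close>: an edge between \<open>u\<close> and \<open>v\<close> is represented
  by the two arcs \<open>(u, v)\<close> and \<open>(v, u)\<close>.
\<close>

definition edge_set :: "'a pair_pre_digraph \<Rightarrow> 'a set set" where
  "edge_set G = (\<lambda>(u, v). {u, v}) ` parcs G"

definition complement :: "'a pair_pre_digraph \<Rightarrow> 'a pair_pre_digraph" where
  "complement G = \<lparr>pverts = pverts G,
     parcs = {(u, v). u \<in> pverts G \<and> v \<in> pverts G \<and> u \<noteq> v \<and> (u, v) \<notin> parcs G}\<rparr>"

text \<open>
  The library predicate \<^const>\<open>tree\<close> cannot be used for symmetric digraphs: \<^const>\<open>forest\<close> also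
  forbids the closed walks \<open>u, v, u\<close> along a single edge. The cycles of an undirected graph
  are the directed cycles of length at least 3. A tree is nonempty, because
  \<^const>\<open>Digraph_Component.connected\<close> excludes the empty graph.
\<close>

definition undirected_tree :: "('a, 'b) pre_digraph \<Rightarrow> bool" where
  "undirected_tree T \<longleftrightarrow>
     graph T \<and> Digraph_Component.connected T \<and>
     \<not> (\<exists>p. pre_digraph.cycle T p \<and> length p \<ge> 3)"

definition free_of :: "'a pair_pre_digraph \<Rightarrow> 'b pair_pre_digraph \<Rightarrow> bool" where
  "free_of H G \<longleftrightarrow> \<not> (\<exists>K. subgraph K (with_proj G) \<and> digraph_iso (with_proj H) K)"

text \<open>
  Up to isomorphism, the graphs on \<open>n\<close> vertices are those with vertex set \<open>{0..<n}\<close>.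
\<close>

definition free_graphs :: "nat \<Rightarrow> 'a pair_pre_digraph \<Rightarrow> nat pair_pre_digraph set" where
  "free_graphs n H = {G. pair_graph G \<and> pverts G = {0..<n} \<and> free_of H G}"

text \<open>
  The maxima below range over finite sets, which are nonempty whenever \<open>H\<close> has an edge.
\<close>

definition turan_number :: "nat \<Rightarrow> 'a pair_pre_digraph \<Rightarrow> nat" where
  "turan_number n H = Max ((\<lambda>G. card (edge_set G)) ` free_graphs n H)"

definition orthonormal_rep :: "'a pair_pre_digraph \<Rightarrow> nat \<Rightarrow> ('a \<Rightarrow> real vec) \<Rightarrow> bool" where
  "orthonormal_rep G d f \<longleftrightarrow>
     (\<forall>u \<in> pverts G. f u \<in> carrier_vec d \<and> sqrt (f u \<bullet> f u) = 1) \<and>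
     (\<forall>u \<in> pverts G. \<forall>v \<in> pverts G. u \<noteq> v \<and> (u, v) \<notin> parcs G \<longrightarrow> f u \<bullet> f v = 0)"

definition gram_matrix :: "nat \<Rightarrow> (nat \<Rightarrow> real vec) \<Rightarrow> real mat" where
  "gram_matrix n f = mat n n (\<lambda>(i, j). f i \<bullet> f j)"

text \<open>
  \<open>\<vartheta>(G)\<close> for a graph \<open>G\<close> with vertex set \<open>{0..<n}\<close>, \<open>n \<ge> 1\<close>: the maximum, over the orthonormal
  representations of the complement of \<open>G\<close> (in any dimension \<open>d\<close>), of the largest eigenvalue
  of the Gram matrix. Each such eigenvalue is at most the trace \<open>n\<close>, so the supremum is
  one of a bounded set; by compactness it is attained.
\<close>

definition lovasz_theta :: "nat pair_pre_digraph \<Rightarrow> real" where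
  "lovasz_theta G =
     Sup {Max (spectrum (gram_matrix (card (pverts G)) f)) |f. \<exists>d. orthonormal_rep (complement G) d f}"

definition lambda_free :: "nat \<Rightarrow> 'a pair_pre_digraph \<Rightarrow> real" where
  "lambda_free n H = Max ((\<lambda>G. lovasz_theta (complement G)) ` free_graphs n H)"

end

theory Submission
  imports Defs
begin

text \<open>
  Let \<open>G\<close> be \<open>H\<close>-free with an orthonormal representation \<open>f\<close> and Gram matrix \<open>M\<close>. The neighbourhood
  of a vertex \<open>u\<close> contains no copy of the tree \<open>H - v\<close>, so it is degenerate and splits into at most
  \<open>h\<close> independent sets; Bessel's inequality on each of them bounds \<open>\<Sum>w\<in>N(u). M u w ^ 2\<close> by \<open>h\<close>.
  The Turan bound, applied to all induced subgraphs, makes \<open>G\<close> itself \<open>D\<close>-degenerate with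
  \<open>D = 2 c n powr \<alpha>\<close>. Orient each edge \<open>u w\<close> so that every vertex \<open>w\<close> has at most \<open>D\<close> in-neighbours \<open>u\<close>
  and estimate \<open>2 M u w x u x w \<le> t (x w) ^ 2 + (x u) ^ 2 (M u w) ^ 2 / t\<close>: the first terms sum to at
  most \<open>t D\<close> and the second to at most \<open>h / t\<close> for a unit vector \<open>x\<close>, so that every eigenvalue is at
  most \<open>1 + 2 sqrt (h D)\<close>.
\<close>

section \<open>Embeddings and H-free graphs\<close>

text \<open>The host is a bare relation \<open>E\<close> with a set \<open>S\<close> of permitted
  images. This lets one edge relation serve while the host shrinks to a neighbourhood or to an
  arbitrary subset of it.\<close>

definition embeds :: "('a, 'b) pre_digraph \<Rightarrow> 'c rel \<Rightarrow> 'c set \<Rightarrow> bool" where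
  "embeds T E S \<longleftrightarrow>
     (\<exists>\<phi>. inj_on \<phi> (verts T) \<and> \<phi> ` verts T \<subseteq> S \<and> (\<forall>e\<in>arcs T. (\<phi> (tail T e), \<phi> (head T e)) \<in> E))"

text \<open>In a pair digraph an arc is determined by its ends, so the arc part of an isomorphism
  onto a subgraph carries no information beyond the vertex map. All later arguments work with vertex
  maps only.\<close>

lemma free_of_iff_not_embeds:
  assumes H: "pair_wf_digraph H" and G: "pair_wf_digraph G"
  shows "free_of H G \<longleftrightarrow> \<not> embeds (with_proj H) (parcs G) (pverts G)"
proof -
  interpret H: pair_wf_digraph H by fact
  interpret G: pair_wf_digraph G by fact
  have wfH: "wf_digraph (with_proj H)" and wfG: "wf_digraph (with_proj G)"
    using H G by (simp_all add: wf_digraph_wp_iff)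
  show ?thesis
  proof
    assume free: "free_of H G"
    show "\<not> embeds (with_proj H) (parcs G) (pverts G)"
    proof
      assume "embeds (with_proj H) (parcs G) (pverts G)"
      then obtain \<phi> where inj: "inj_on \<phi> (pverts H)" and sub: "\<phi> ` pverts H \<subseteq> pverts G"
        and arcs: "\<And>x y. (x, y) \<in> parcs H \<Longrightarrow> (\<phi> x, \<phi> y) \<in> parcs G"
        unfolding embeds_def by fastforce
      have parcs: "parcs H \<subseteq> pverts H \<times> pverts H"
        using H.arc_fst_in_verts H.arc_snd_in_verts by fastforce
      \<comment> \<open>Arcs must be moved by \<open>map_prod\<close> and the new end maps must be
        \<open>fst\<close> and \<open>snd\<close>, since a subgraph shares the end maps of its
        host.\<close>
      define i where "i = \<lparr>iso_verts = \<phi>, iso_arcs = map_prod \<phi> \<phi>, iso_head = snd, iso_tail = fst\<rparr>"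
      have iso: "pre_digraph.digraph_isomorphism (with_proj H) i"
        unfolding pre_digraph.digraph_isomorphism_def i_def
        using wfH inj inj_on_subset[OF map_prod_inj_on[OF inj inj], of "parcs H"] parcs by auto
      have "subgraph (app_iso i (with_proj H)) (with_proj G)"
        unfolding subgraph_def compatible_def
        using wfG wf_digraph.wf_digraphI_app_iso[OF wfH iso] sub arcs by (auto simp: i_def)
      with free iso show False unfolding free_of_def digraph_iso_def by blast
    qed
  next
    assume no: "\<not> embeds (with_proj H) (parcs G) (pverts G)"
    show "free_of H G" unfolding free_of_def
    proof
      assume "\<exists>K. subgraph K (with_proj G) \<and> digraph_iso (with_proj H) K"
      then obtain i where i: "pre_digraph.digraph_isomorphism (with_proj H) i"
        and sub: "subgraph (app_iso i (with_proj H)) (with_proj G)"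
        unfolding digraph_iso_def by blast
      \<comment> \<open>Compatibility with the host forces the end maps of the image, and thereby
        fixes where each arc goes.\<close>
      have tl: "iso_tail i = fst" "iso_head i = snd"
        using sub unfolding subgraph_def compatible_def by auto
      have "(iso_verts i (fst e), iso_verts i (snd e)) \<in> parcs G" if e: "e \<in> parcs H" for e
      proof -
        have "iso_arcs i e = (iso_verts i (fst e), iso_verts i (snd e))"
          using i e unfolding pre_digraph.digraph_isomorphism_def tl by (auto simp: prod_eq_iff)
        then show ?thesis using sub e unfolding subgraph_def by auto
      qed
      moreover have "inj_on (iso_verts i) (pverts H)" "iso_verts i ` pverts H \<subseteq> pverts G"
        using i sub unfolding pre_digraph.digraph_isomorphism_def subgraph_def by auto
      ultimately have "embeds (with_proj H) (parcs G) (pverts G)"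
        unfolding embeds_def by auto
      with no show False ..
    qed
  qed
qed

section \<open>Greedy embedding of trees\<close>

text \<open>Connectedness is phrased through vertex-simple paths of \<open>T\<close> that stay
  inside \<open>A\<close>, because such a path can be closed up to a cycle by a vertex outside
  \<open>A\<close>.\<close>

definition path_connected_in :: "('a, 'b) pre_digraph \<Rightarrow> 'a set \<Rightarrow> bool" where
  "path_connected_in T A \<longleftrightarrow>
     (\<forall>x\<in>A. \<forall>y\<in>A. \<exists>p. pre_digraph.apath T x p y \<and> set (pre_digraph.awalk_verts T x p) \<subseteq> A)"

text \<open>Paths inside \<open>A\<close> avoid \<open>b\<close>, so prefixing \<open>e'\<close> or
  appending \<open>e\<close> keeps them vertex-simple.\<close>

lemma (in wf_digraph) path_connected_in_insert:
  assumes A: "path_connected_in G A" and a: "a \<in> A" "b \<notin> A"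
    and e: "e \<in> arcs G" "tail G e = a" "head G e = b"
    and e': "e' \<in> arcs G" "tail G e' = b" "head G e' = a"
  shows "path_connected_in G (insert b A)"
  unfolding path_connected_in_def
proof (intro ballI)
  fix x y assume xy: "x \<in> insert b A" "y \<in> insert b A"
  have bv: "b \<in> verts G" using e by auto
  have P: "\<exists>p. apath x p y \<and> set (awalk_verts x p) \<subseteq> A" if "x \<in> A" "y \<in> A" for x y
    using A that unfolding path_connected_in_def by blast
  consider "x \<in> A" "y \<in> A" | "x = b" "y = b" | "x = b" "y \<in> A" | "x \<in> A" "y = b" using xy by blast
  then show "\<exists>p. apath x p y \<and> set (awalk_verts x p) \<subseteq> insert b A"
  proof cases
    case 1 with P show ?thesis by blast
  next
    case 2 with bv show ?thesis by (intro exI[of _ "[]"]) (auto simp: apath_Nil_iff)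
  next
    case 3
    obtain p where p: "apath a p y" "set (awalk_verts a p) \<subseteq> A" using P a 3 by blast
    then show ?thesis using 3 e' a
      by (intro exI[of _ "e' # p"]) (auto simp: apath_Cons_iff)
  next
    case 4
    obtain p where p: "apath x p a" "set (awalk_verts x p) \<subseteq> A" using P a 4 by blast
    then have w: "awalk x p a" by (simp add: awalkI_apath)
    have w': "awalk x (p @ [e]) b" using w arc_implies_awalk[OF e(1)] e by auto
    have v: "awalk_verts x (p @ [e]) = awalk_verts x p @ [b]"
      using awalk_verts_append[OF w'] e by simp
    show ?thesis using 4 p w' v a
      by (intro exI[of _ "p @ [e]"]) (auto simp: apath_def)
  qed
qed

text \<open>Connectedness supplies an arc \<open>e\<close> leaving \<open>A\<close>. If its head
  \<open>b\<close> had a second neighbour in \<open>A\<close>, a path inside \<open>A\<close>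
  between the two neighbours would close to a cycle through \<open>b\<close>.\<close>

lemma undirected_tree_exit:
  assumes T: "undirected_tree T" and A: "path_connected_in T A" "A \<subset> verts T" "A \<noteq> {}"
  shows "\<exists>e\<in>arcs T. \<exists>e'\<in>arcs T. tail T e \<in> A \<and> head T e \<in> verts T - A \<and>
    tail T e' = head T e \<and> head T e' = tail T e \<and>
    (\<forall>d\<in>arcs T. tail T d \<in> A \<longrightarrow> head T d = head T e \<longrightarrow> tail T d = tail T e)"
proof -
  interpret graph T using T by (simp add: undirected_tree_def)
  have rev: "\<exists>e'\<in>arcs T. tail T e' = head T e \<and> head T e' = tail T e" if "e \<in> arcs T" for e
  proof -
    have "(head T e, tail T e) \<in> arcs_ends T"
      using sym_arcs that unfolding symmetric_def sym_def arcs_ends_conv by blast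
    then show ?thesis unfolding arcs_ends_conv by force
  qed
  have "\<exists>e\<in>arcs T. tail T e \<in> A \<and> head T e \<notin> A"
  proof (rule ccontr)
    assume no: "\<not> ?thesis"
    obtain x y where xy: "x \<in> A" "y \<in> verts T" "y \<notin> A" using A by blast
    have "x \<rightarrow>\<^sup>*\<^bsub>mk_symmetric T\<^esub> y"
      using T xy A unfolding undirected_tree_def connected_def strongly_connected_def by auto
    then have "(x, y) \<in> rtrancl_on (verts T) (arcs_ends T)"
      unfolding reachable_def using adj_mk_symmetric_eq[OF sym_arcs] by simp
    then have "y \<in> A"
    proof (induction rule: rtrancl_on_induct)
      case base show ?case by fact
    next
      case (step y z) then show ?case using no by (auto simp: arcs_ends_conv)
    qed
    with xy show False by simp
  qed
  then obtain e where e: "e \<in> arcs T" "tail T e \<in> A" "head T e \<notin> A" by blast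
  obtain e' where e': "e' \<in> arcs T" "tail T e' = head T e" "head T e' = tail T e" using rev[OF e(1)] by blast
  have uniq: "tail T d = tail T e" if d: "d \<in> arcs T" "tail T d \<in> A" "head T d = head T e" for d
  proof (rule ccontr)
    assume neq: "tail T d \<noteq> tail T e"
    let ?a = "tail T e" and ?b = "head T e"
    obtain p where p: "apath ?a p (tail T d)" "set (awalk_verts ?a p) \<subseteq> A"
      using A(1) e d unfolding path_connected_in_def by blast
    have w: "awalk ?a p (tail T d)" using p by (simp add: awalkI_apath)
    have w': "awalk ?a (p @ [d]) ?b" using w arc_implies_awalk[OF d(1)] d(3) by auto
    have v: "awalk_verts ?a (p @ [d]) = awalk_verts ?a p @ [?b]"
      using awalk_verts_append[OF w'] d by simp
    \<comment> \<open>Two distinct neighbours make the path nonempty, hence the cycle has length at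
      least 3 and is not a mere walk back and forth along one edge.\<close>
    have "p \<noteq> []" using p(1) neq by (auto simp: apath_Nil_iff)
    then have len: "length (e' # p @ [d]) \<ge> 3" by (cases p) auto
    have "cycle (e' # p @ [d])"
      unfolding cycle_def
      using w' v e' e p by (intro exI[of _ ?b]) (auto simp: awalk_Cons_iff apath_def)
    with len T show False unfolding undirected_tree_def by blast
  qed
  then have "\<forall>d\<in>arcs T. tail T d \<in> A \<longrightarrow> head T d = head T e \<longrightarrow> tail T d = tail T e"
    by blast
  moreover have "head T e \<in> verts T - A" using e by simp
  ultimately show ?thesis using e e' by blast
qed

text \<open>Greedy embedding: each new tree vertex has a single neighbour \<open>a\<close> among
  those already placed, so it only needs an unoccupied neighbour of the image of
  \<open>a\<close>.\<close>

lemma undirected_tree_embeds: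
  assumes T: "undirected_tree T"
    and S: "finite S" "S \<noteq> {}" and E: "sym E"
    and deg: "\<And>w. w \<in> S \<Longrightarrow> card (verts T) - 1 \<le> card {x \<in> S. (w, x) \<in> E}"
    and irr: "\<And>w. (w, w) \<notin> E"
  shows "embeds T E S"
proof -
  interpret graph T using T by (simp add: undirected_tree_def)
  have ne: "verts T \<noteq> {}"
    using T unfolding undirected_tree_def connected_def strongly_connected_def by simp
  \<comment> \<open>The induction starts from a single vertex. Path-connectedness of the placed part
    is carried along because the choice of the next vertex relies on it.\<close>
  have "Suc k \<le> card (verts T) \<Longrightarrow> \<exists>A \<phi>. A \<subseteq> verts T \<and> card A = Suc k \<and> path_connected_in T A \<and>
     inj_on \<phi> A \<and> \<phi> ` A \<subseteq> S \<and>
     (\<forall>e\<in>arcs T. tail T e \<in> A \<longrightarrow> head T e \<in> A \<longrightarrow> (\<phi> (tail T e), \<phi> (head T e)) \<in> E)" for k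
  proof (induction k)
    case 0
    obtain r s where "r \<in> verts T" "s \<in> S" using ne S by blast
    moreover from this have "apath r [] r" by (simp add: apath_Nil_iff)
    then have "path_connected_in T {r}"
      unfolding path_connected_in_def by (simp, intro exI[of _ "[]"]) simp
    moreover have "\<not> (tail T e = r \<and> head T e = r)" if "e \<in> arcs T" for e
      using no_loops[OF that] by auto
    ultimately show ?case
      by (intro exI[of _ "{r}"] exI[of _ "\<lambda>_. s"]) auto
  next
    case (Suc k)
    then obtain A \<phi> where A: "A \<subseteq> verts T" "card A = Suc k" "path_connected_in T A"
      "inj_on \<phi> A" "\<phi> ` A \<subseteq> S"
      and \<phi>: "\<And>e. e \<in> arcs T \<Longrightarrow> tail T e \<in> A \<Longrightarrow> head T e \<in> A \<Longrightarrow> (\<phi> (tail T e), \<phi> (head T e)) \<in> E"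
      by auto
    have finA: "finite A" using A(2) card.infinite by fastforce
    have "A \<noteq> verts T" using A Suc.prems by auto
    then have "A \<subset> verts T" "A \<noteq> {}" using A by auto
    from undirected_tree_exit[OF T A(3) this] obtain a b e e' where ab: "a \<in> A" "b \<in> verts T - A"
      and e: "e \<in> arcs T" "tail T e = a" "head T e = b"
      and e': "e' \<in> arcs T" "tail T e' = b" "head T e' = a"
      and uniq: "\<forall>d\<in>arcs T. tail T d \<in> A \<longrightarrow> head T d = b \<longrightarrow> tail T d = a"
      by blast
    have uniq': "head T d = a" if d: "d \<in> arcs T" "head T d \<in> A" "tail T d = b" for d
    proof -
      have "(head T d, tail T d) \<in> arcs_ends T"
        using sym_arcs that unfolding symmetric_def sym_def arcs_ends_conv by blast
      then obtain d' where "d' \<in> arcs T" "tail T d' = head T d" "head T d' = tail T d"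
        unfolding arcs_ends_conv by force
      with uniq d show ?thesis by simp
    qed
    \<comment> \<open>The image of \<open>a\<close> is not its own neighbour, so at most
      \<open>k\<close> of its neighbours are occupied, while the degree condition gives it at least
      \<open>k + 1\<close>.\<close>
    have "\<not> {x \<in> S. (\<phi> a, x) \<in> E} \<subseteq> \<phi> ` (A - {a})"
    proof
      assume "{x \<in> S. (\<phi> a, x) \<in> E} \<subseteq> \<phi> ` (A - {a})"
      then have "card {x \<in> S. (\<phi> a, x) \<in> E} \<le> card (A - {a})"
        using finA by (meson card_image_le card_mono finite_Diff finite_imageI le_trans)
      also have "\<dots> = k" using A ab finA by simp
      finally show False using deg[of "\<phi> a"] A ab Suc.prems by auto
    qed
    then obtain z where z: "z \<in> S" "(\<phi> a, z) \<in> E" "z \<notin> \<phi> ` (A - {a})" by blast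
    then have z': "z \<notin> \<phi> ` A" using irr by auto
    have zs: "(z, \<phi> a) \<in> E" using z E by (meson symE)
    define \<psi> where "\<psi> = \<phi>(b := z)"
    have \<psi>: "\<psi> b = z" "\<And>x. x \<in> A \<Longrightarrow> \<psi> x = \<phi> x" using ab by (auto simp: \<psi>_def)
    have "path_connected_in T (insert b A)"
      using path_connected_in_insert[OF A(3) ab(1) _ e e'] ab by blast
    moreover have "inj_on \<psi> (insert b A)"
      using A z' ab \<psi> by (auto simp: inj_on_def image_iff)
    moreover have "\<psi> ` insert b A \<subseteq> S" using A z \<psi> by auto
    moreover have "(\<psi> (tail T d), \<psi> (head T d)) \<in> E"
      if d: "d \<in> arcs T" "tail T d \<in> insert b A" "head T d \<in> insert b A" for d
    proof -
      have nl: "tail T d \<noteq> head T d" using d no_loops by blast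
      consider "tail T d \<in> A" "head T d \<in> A" | "tail T d = b" "head T d \<in> A" | "tail T d \<in> A" "head T d = b"
        using d nl by auto
      then show ?thesis
      proof cases
        case 1 then show ?thesis using \<phi>[OF d(1)] \<psi> by simp
      next
        case 2 then show ?thesis using uniq'[OF d(1)] zs ab \<psi> by simp
      next
        case 3 then show ?thesis using uniq d(1) z ab \<psi> by simp
      qed
    qed
    moreover have "card (insert b A) = Suc (Suc k)" using finA A ab by simp
    moreover have "insert b A \<subseteq> verts T" using A ab by simp
    ultimately show ?case by blast
  qed
  from this[of "card (verts T) - 1"] obtain A \<phi> where A: "A \<subseteq> verts T" "card A = card (verts T)"
     "inj_on \<phi> A" "\<phi> ` A \<subseteq> S"
     "\<forall>e\<in>arcs T. tail T e \<in> A \<longrightarrow> head T e \<in> A \<longrightarrow> (\<phi> (tail T e), \<phi> (head T e)) \<in> E"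
    using ne by (auto simp: card_gt_0_iff Suc_le_eq)
  then have "A = verts T" by (simp add: card_subset_eq)
  with A show ?thesis unfolding embeds_def by auto
qed

section \<open>Degenerate graphs and quadratic forms\<close>

text \<open>Remove a vertex with fewer than \<open>k\<close> neighbours and colour the rest; the
  neighbours leave one of the \<open>k\<close> colours free for it.\<close>

lemma degenerate_colouring:
  assumes "finite S" and E: "sym E" "\<And>w. (w, w) \<notin> E"
    and deg: "\<And>U. U \<subseteq> S \<Longrightarrow> U \<noteq> {} \<Longrightarrow> \<exists>w\<in>U. card {x \<in> U. (w, x) \<in> E} < k"
  shows "\<exists>\<kappa>. (\<forall>x\<in>S. \<kappa> x < k) \<and> (\<forall>x\<in>S. \<forall>y\<in>S. (x, y) \<in> E \<longrightarrow> \<kappa> x \<noteq> (\<kappa> y :: nat))"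
  using assms(1) deg
proof (induction S rule: finite_psubset_induct)
  case (psubset S)
  show ?case
  proof (cases "S = {}")
    case False
    then obtain w where w: "w \<in> S" "card {x \<in> S. (w, x) \<in> E} < k" using psubset.prems by blast
    have "S - {w} \<subset> S" using w by blast
    moreover have "\<exists>w\<in>U. card {x \<in> U. (w, x) \<in> E} < k" if "U \<subseteq> S - {w}" "U \<noteq> {}" for U
      using psubset.prems that by blast
    ultimately obtain \<kappa> where \<kappa>: "\<forall>x\<in>S-{w}. \<kappa> x < k"
      "\<forall>x\<in>S-{w}. \<forall>y\<in>S-{w}. (x, y) \<in> E \<longrightarrow> \<kappa> x \<noteq> \<kappa> y"
      using psubset.IH[of "S - {w}"] by blast
    have "card (\<kappa> ` {x \<in> S. (w, x) \<in> E}) < k"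
      using w(2) psubset.hyps card_image_le[of "{x \<in> S. (w, x) \<in> E}" \<kappa>] by simp
    then have "\<not> {..<k} \<subseteq> \<kappa> ` {x \<in> S. (w, x) \<in> E}"
      using card_mono[of "\<kappa> ` {x \<in> S. (w, x) \<in> E}" "{..<k}"] psubset.hyps by auto
    then obtain i where i: "i < k" "i \<notin> \<kappa> ` {x \<in> S. (w, x) \<in> E}" by blast
    have "(\<forall>x\<in>S. (\<kappa>(w := i)) x < k) \<and> 
      (\<forall>x\<in>S. \<forall>y\<in>S. (x, y) \<in> E \<longrightarrow> (\<kappa>(w := i)) x \<noteq> (\<kappa>(w := i)) y)"
      using i \<kappa> E by (auto simp: image_iff dest: symD)
    then show ?thesis by blast
  qed simp
qed

lemma sum_sum_insert:
  fixes F :: "'a \<Rightarrow> 'a \<Rightarrow> real"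
  assumes "finite S" "w \<notin> S"
  shows "(\<Sum>u\<in>insert w S. \<Sum>v\<in>insert w S. F u v) =
    (\<Sum>u\<in>S. \<Sum>v\<in>S. F u v) + (\<Sum>u\<in>S. F u w) + (\<Sum>v\<in>S. F w v) + F w w"
  using assms by (simp add: sum.distrib)

text \<open>The orientation of the edges is given by the order of deletion: a vertex
  \<open>w\<close> of degree at most \<open>D\<close> is removed, and its edges to the remaining
  vertices are charged to \<open>w\<close>. The last sum runs over ordered pairs so that it can
  later be estimated row by row.\<close>

lemma degenerate_quadratic_form_bound:
  fixes M :: "'a \<Rightarrow> 'a \<Rightarrow> real" and x :: "'a \<Rightarrow> real"
  assumes "finite S" and t: "t > 0" and D: "D \<ge> 0"
    and sym: "\<And>u w. M u w = M w u"
    and diag: "\<And>u. u \<in> S \<Longrightarrow> M u u = 1"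
    and zero: "\<And>u w. u \<in> S \<Longrightarrow> w \<in> S \<Longrightarrow> u \<noteq> w \<Longrightarrow> (u, w) \<notin> E \<Longrightarrow> M u w = 0"
    and deg: "\<And>U. U \<subseteq> S \<Longrightarrow> U \<noteq> {} \<Longrightarrow> \<exists>w\<in>U. real (card {x \<in> U. (w, x) \<in> E}) \<le> D"
  shows "(\<Sum>u\<in>S. \<Sum>w\<in>S. M u w * x u * x w) \<le>
    (1 + t * D) * (\<Sum>u\<in>S. (x u)\<^sup>2) +
    (\<Sum>u\<in>S. \<Sum>w\<in>S. if u = w then 0 else (x u)\<^sup>2 * (M u w)\<^sup>2) / t"
  using assms(1) diag zero deg
proof (induction S rule: finite_psubset_induct)
  case (psubset S)
  show ?case
  proof (cases "S = {}")
    case False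
    then obtain w where w: "w \<in> S" "real (card {x \<in> S. (w, x) \<in> E}) \<le> D" using psubset.prems(3) by blast
    define S' where "S' = S - {w}"
    have S': "S = insert w S'" "w \<notin> S'" "S' \<subset> S" "finite S'"
      using w psubset.hyps by (auto simp: S'_def)
    let ?Q = "\<lambda>S. \<Sum>u\<in>S. \<Sum>w\<in>S. M u w * x u * x w"
    let ?R = "\<lambda>S. \<Sum>u\<in>S. \<Sum>w\<in>S. if u = w then 0 else (x u)\<^sup>2 * (M u w)\<^sup>2"
    have IH: "?Q S' \<le> (1 + t * D) * (\<Sum>u\<in>S'. (x u)\<^sup>2) + ?R S' / t"
    proof (rule psubset.IH[OF S'(3)])
      show "\<And>U. U \<subseteq> S' \<Longrightarrow> U \<noteq> {} \<Longrightarrow> \<exists>w\<in>U. real (card {x \<in> U. (w, x) \<in> E}) \<le> D"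
        using psubset.prems(3) S'(3) by blast
    qed (use psubset.prems(1,2) S'(3) in auto)
    have Q: "?Q S = ?Q S' + 2 * (\<Sum>u\<in>S'. M u w * x u * x w) + (x w)\<^sup>2"
    proof -
      have "(\<Sum>v\<in>S'. M w v * x w * x v) = (\<Sum>u\<in>S'. M u w * x u * x w)"
        by (intro sum.cong refl) (subst sym, simp)
      then show ?thesis
        using psubset.prems(1)[OF w(1)]
        unfolding S'(1) sum_sum_insert[OF S'(4,2)] by (simp add: power2_eq_square)
    qed
    have R: "?R S = ?R S' + (\<Sum>u\<in>S'. (x u)\<^sup>2 * (M u w)\<^sup>2) + (\<Sum>v\<in>S'. (x w)\<^sup>2 * (M w v)\<^sup>2)"
    proof -
      have "(\<Sum>u\<in>S'. if u = w then 0 else (x u)\<^sup>2 * (M u w)\<^sup>2) = (\<Sum>u\<in>S'. (x u)\<^sup>2 * (M u w)\<^sup>2)"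
        "(\<Sum>v\<in>S'. if w = v then 0 else (x w)\<^sup>2 * (M w v)\<^sup>2) = (\<Sum>v\<in>S'. (x w)\<^sup>2 * (M w v)\<^sup>2)"
        using S'(2) by (auto intro!: sum.cong)
      then show ?thesis unfolding S'(1) sum_sum_insert[OF S'(4,2)] by simp
    qed
    let ?N = "{u \<in> S. (w, u) \<in> E}"
    have "2 * (\<Sum>u\<in>S'. M u w * x u * x w) \<le>
        (\<Sum>u\<in>S'. (if u \<in> ?N then t * (x w)\<^sup>2 else 0) + (x u)\<^sup>2 * (M u w)\<^sup>2 / t)"
      unfolding sum_distrib_left
    proof (rule sum_mono)
      fix u assume u: "u \<in> S'"
      show "2 * (M u w * x u * x w) \<le> (if u \<in> ?N then t * (x w)\<^sup>2 else 0) + (x u)\<^sup>2 * (M u w)\<^sup>2 / t"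
      proof (cases "u \<in> ?N")
        case True
        \<comment> \<open>The weighted inequality between arithmetic and geometric mean, obtained
          from a square.\<close>
        have "0 \<le> (t * x w - x u * M u w)\<^sup>2 / t" using t by simp
        also have "\<dots> = t * (x w)\<^sup>2 + (x u)\<^sup>2 * (M u w)\<^sup>2 / t - 2 * (M u w * x u * x w)"
          using t by (simp add: field_simps power2_eq_square)
        finally show ?thesis using True by simp
      next
        case False
        then have "M w u = 0" using psubset.prems(2)[of w u] u w S' by auto
        then show ?thesis using sym[of u w] t by simp
      qed
    qed
    also have "\<dots> = real (card (S' \<inter> ?N)) * (t * (x w)\<^sup>2) + (\<Sum>u\<in>S'. (x u)\<^sup>2 * (M u w)\<^sup>2) / t"
      using S'(4) by (simp add: sum.distrib sum_divide_distrib sum.If_cases)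
    also have "real (card (S' \<inter> ?N)) * (t * (x w)\<^sup>2) \<le> D * (t * (x w)\<^sup>2)"
    proof (rule mult_right_mono)
      have "card (S' \<inter> ?N) \<le> card ?N" using psubset.hyps by (intro card_mono) auto
      then show "real (card (S' \<inter> ?N)) \<le> D" using w(2) by linarith
    qed (use t in simp)
    finally have "2 * (\<Sum>u\<in>S'. M u w * x u * x w) \<le> D * (t * (x w)\<^sup>2) + (\<Sum>u\<in>S'. (x u)\<^sup>2 * (M u w)\<^sup>2) / t"
      by simp
    \<comment> \<open>The row of \<open>w\<close> in \<open>?R S\<close> is nonnegative, so
      including it only enlarges the right-hand side.\<close>
    moreover have "(\<Sum>v\<in>S'. (x w)\<^sup>2 * (M w v)\<^sup>2) / t \<ge> 0" using t by (simp add: sum_nonneg)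
    moreover have "(\<Sum>u\<in>S. (x u)\<^sup>2) = (x w)\<^sup>2 + (\<Sum>u\<in>S'. (x u)\<^sup>2)" unfolding S'(1) using S' by simp
    ultimately show ?thesis using IH unfolding Q R
      by (simp add: algebra_simps add_divide_distrib)
  qed simp
qed

section \<open>Vectors\<close>

text \<open>The squared distance from \<open>u\<close> to its orthogonal projection onto the span of
  the family is nonnegative.\<close>

lemma bessel_inequality:
  fixes u :: "real vec" and f :: "'b \<Rightarrow> real vec"
  assumes "finite C" and u: "u \<in> carrier_vec d" and f: "\<And>w. w \<in> C \<Longrightarrow> f w \<in> carrier_vec d"
    and unit: "\<And>w. w \<in> C \<Longrightarrow> f w \<bullet> f w = 1"
    and orth: "\<And>w w'. w \<in> C \<Longrightarrow> w' \<in> C \<Longrightarrow> w \<noteq> w' \<Longrightarrow> f w \<bullet> f w' = 0"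
  shows "(\<Sum>w\<in>C. (u \<bullet> f w)\<^sup>2) \<le> u \<bullet> u"
proof -
  define g where "g w = u \<bullet> f w" for w
  \<comment> \<open>The coordinates of that projection; working with coordinates turns the inner
    products into finite sums that can be exchanged.\<close>
  define p where "p i = (\<Sum>w\<in>C. g w * f w $ i)" for i
  have up: "(\<Sum>i<d. u $ i * p i) = (\<Sum>w\<in>C. (g w)\<^sup>2)"
  proof -
    have "(\<Sum>i<d. u $ i * p i) = (\<Sum>w\<in>C. \<Sum>i<d. u $ i * (g w * f w $ i))"
      unfolding p_def sum_distrib_left by (rule sum.swap)
    also have "\<dots> = (\<Sum>w\<in>C. g w * g w)"
    proof (intro sum.cong refl)
      fix w assume "w \<in> C"
      then have "(\<Sum>i<d. u $ i * f w $ i) = g w"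
        using carrier_vecD[OF f] by (simp add: g_def scalar_prod_def lessThan_atLeast0)
      then show "(\<Sum>i<d. u $ i * (g w * f w $ i)) = g w * g w"
        by (simp add: mult.left_commute flip: sum_distrib_left)
    qed
    finally show ?thesis by (simp add: power2_eq_square)
  qed
  have pp: "(\<Sum>i<d. (p i)\<^sup>2) = (\<Sum>w\<in>C. (g w)\<^sup>2)"
  proof -
    have "(\<Sum>i<d. (p i)\<^sup>2) = (\<Sum>i<d. \<Sum>w\<in>C. \<Sum>w'\<in>C. (g w * f w $ i) * (g w' * f w' $ i))"
      unfolding p_def power2_eq_square sum_product ..
    also have "\<dots> = (\<Sum>w\<in>C. \<Sum>w'\<in>C. \<Sum>i<d. (g w * f w $ i) * (g w' * f w' $ i))"
      by (subst sum.swap, intro sum.cong refl, rule sum.swap)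
    also have "\<dots> = (\<Sum>w\<in>C. \<Sum>w'\<in>C. g w * g w' * (f w \<bullet> f w'))"
    proof (intro sum.cong refl)
      fix w w' assume "w' \<in> C"
      then show "(\<Sum>i<d. (g w * f w $ i) * (g w' * f w' $ i)) = g w * g w' * (f w \<bullet> f w')"
        using carrier_vecD[OF f]
        by (simp add: scalar_prod_def sum_distrib_left lessThan_atLeast0 mult.assoc mult.left_commute)
    qed
    also have "\<dots> = (\<Sum>w\<in>C. \<Sum>w'\<in>C. if w' = w then (g w)\<^sup>2 else 0)"
      using unit orth by (intro sum.cong refl) (auto simp: power2_eq_square)
    also have "\<dots> = (\<Sum>w\<in>C. (g w)\<^sup>2)" using assms(1) by simp
    finally show ?thesis .
  qed
  have "0 \<le> (\<Sum>i<d. (u $ i - p i)\<^sup>2)" by (simp add: sum_nonneg)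
  also have "\<dots> = (\<Sum>i<d. u $ i * u $ i) - 2 * (\<Sum>i<d. u $ i * p i) + (\<Sum>i<d. (p i)\<^sup>2)"
    by (simp add: power2_diff sum.distrib sum_subtractf sum_distrib_left algebra_simps power2_eq_square)
  also have "(\<Sum>i<d. u $ i * u $ i) = u \<bullet> u" using u by (simp add: scalar_prod_def lessThan_atLeast0)
  finally show ?thesis unfolding up pp g_def by simp
qed

text \<open>A complex eigenvalue \<open>k\<close> exists, and symmetry makes it real: the form
  \<open>q\<close> equals both its own conjugate and \<open>k\<close> times the positive squared
  norm of the eigenvector.\<close>

lemma symmetric_real_spectrum_nonempty:
  fixes A :: "real mat"
  assumes A: "A \<in> carrier_mat n n" and n: "n > 0"
    and sym: "\<And>i j. i < n \<Longrightarrow> j < n \<Longrightarrow> A $$ (i, j) = A $$ (j, i)"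
  shows "spectrum A \<noteq> {}"
proof -
  define B where "B = map_mat complex_of_real A"
  have B: "B \<in> carrier_mat n n" using A by (simp add: B_def)
  obtain k where "k \<in> spectrum B" using spectrum_non_empty[OF B n] by blast
  then obtain x where x: "x \<in> carrier_vec n" "x \<noteq> 0\<^sub>v n" "B *\<^sub>v x = k \<cdot>\<^sub>v x"
    using B unfolding spectrum_def eigenvalue_def eigenvector_def by auto
  have Bx: "(\<Sum>j<n. complex_of_real (A $$ (i, j)) * x $ j) = k * x $ i" if "i < n" for i
  proof -
    have "(B *\<^sub>v x) $ i = (\<Sum>j<n. complex_of_real (A $$ (i, j)) * x $ j)"
      using that A x(1) by (auto simp: B_def scalar_prod_def lessThan_atLeast0 intro!: sum.cong)
    then show ?thesis using x that by simp
  qed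
  define s where "s = (\<Sum>i<n. (cmod (x $ i))\<^sup>2)"
  define q where "q = (\<Sum>i<n. \<Sum>j<n. complex_of_real (A $$ (i, j)) * cnj (x $ i) * x $ j)"
  have q: "q = k * of_real s"
  proof -
    have "q = (\<Sum>i<n. cnj (x $ i) * (\<Sum>j<n. complex_of_real (A $$ (i, j)) * x $ j))"
      unfolding q_def sum_distrib_left by (intro sum.cong refl) simp
    also have "\<dots> = (\<Sum>i<n. k * of_real ((cmod (x $ i))\<^sup>2))"
      using Bx by (intro sum.cong refl) (simp add: complex_norm_square del: of_real_power)
    finally show ?thesis by (simp add: s_def sum_distrib_left)
  qed
  have "cnj q = (\<Sum>i<n. \<Sum>j<n. complex_of_real (A $$ (i, j)) * x $ i * cnj (x $ j))"
    by (simp add: q_def)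
  also have "\<dots> = (\<Sum>j<n. \<Sum>i<n. complex_of_real (A $$ (i, j)) * x $ i * cnj (x $ j))"
    by (rule sum.swap)
  also have "\<dots> = q" unfolding q_def using sym by (intro sum.cong refl) simp
  finally have "cnj q = q" .
  moreover have "s > 0"
  proof -
    obtain i where "i < n" "x $ i \<noteq> 0" using x(1,2) by (metis eq_vecI index_zero_vec carrier_vecD)
    then show ?thesis unfolding s_def by (intro sum_pos2[of _ i]) auto
  qed
  ultimately have "cnj k = k" unfolding q by simp
  then obtain r where r: "k = of_real r" by (metis Reals_cases Reals_cnj_iff)
  \<comment> \<open>The characteristic polynomial of \<open>B\<close> is that of \<open>A\<close>
    with coefficients embedded in the complex numbers, so the real root descends to
    \<open>A\<close>.\<close>
  have "poly (char_poly B) k = 0"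
    using eigenvalue_root_char_poly[OF B] x B unfolding eigenvalue_def eigenvector_def by auto
  then have "poly (char_poly A) r = 0"
    unfolding B_def of_real_hom.char_poly_hom[OF A] r by (simp add: of_real_hom.poly_map_poly)
  then show ?thesis using spectrum_root_char_poly[OF A] by blast
qed

section \<open>Degeneracy of H-free graphs\<close>

lemma symmetric_with_proj_iff: "symmetric (with_proj G) \<longleftrightarrow> sym (parcs G)"
  by (simp add: symmetric_def)

lemma pair_graph_iff:
  "pair_graph G \<longleftrightarrow> finite (pverts G) \<and> parcs G \<subseteq> pverts G \<times> pverts G \<and> sym (parcs G) \<and> irrefl (parcs G)"
proof
  assume "pair_graph G"
  then interpret pair_graph G .
  show "finite (pverts G) \<and> parcs G \<subseteq> pverts G \<times> pverts G \<and> sym (parcs G) \<and> irrefl (parcs G)"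
    using pair_finite_verts arc_fst_in_verts arc_snd_in_verts pair_sym_arcs pair_no_loops
    by (fastforce simp: symmetric_with_proj_iff irrefl_def)
next
  assume G: "finite (pverts G) \<and> parcs G \<subseteq> pverts G \<times> pverts G \<and> sym (parcs G) \<and> irrefl (parcs G)"
  then have "finite (parcs G)" by (meson finite_SigmaI finite_subset)
  with G show "pair_graph G"
    by unfold_locales (auto simp: symmetric_with_proj_iff irrefl_def)
qed

lemma pair_graph_imp_wf: "pair_graph G \<Longrightarrow> pair_wf_digraph G"
  by (simp add: pair_graph_def pair_digraph_def pair_fin_digraph_def)

text \<open>At most two arcs share the same unordered pair of ends. This converts a bound on edges
  into a bound on the sum of degrees.\<close>

lemma card_parcs_le_edge_set:
  assumes "finite (parcs G)"
  shows "card (parcs G) \<le> 2 * card (edge_set G)"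
proof -
  let ?f = "\<lambda>(u, v). {u, v}"
  have "card (parcs G) = (\<Sum>s\<in>edge_set G. card {e \<in> parcs G. ?f e = s})"
    unfolding edge_set_def card_eq_sum by (rule sum.image_gen[OF assms])
  also have "\<dots> \<le> (\<Sum>s\<in>edge_set G. 2)"
  proof (rule sum_mono)
    fix s assume "s \<in> edge_set G"
    then obtain u v where s: "s = {u, v}" by (auto simp: edge_set_def)
    have "{e \<in> parcs G. ?f e = s} \<subseteq> {(u, v), (v, u)}"
    proof
      fix e assume "e \<in> {e \<in> parcs G. ?f e = s}"
      then have "{fst e, snd e} = {u, v}" by (simp add: s case_prod_beta)
      then show "e \<in> {(u, v), (v, u)}" by (simp add: doubleton_eq_iff prod_eq_iff)
    qed
    then have "card {e \<in> parcs G. ?f e = s} \<le> card {(u, v), (v, u)}" by (intro card_mono) auto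
    also have "\<dots> \<le> 2" by (cases "u = v") simp_all
    finally show "card {e \<in> parcs G. ?f e = s} \<le> 2" .
  qed
  finally show ?thesis by simp
qed

lemma finite_free_graphs: "finite (free_graphs n H)"
proof (rule finite_subset)
  show "free_graphs n H \<subseteq> (\<lambda>E. \<lparr>pverts = {0..<n}, parcs = E\<rparr>) ` Pow ({0..<n} \<times> {0..<n})"
  proof
    fix G assume G: "G \<in> free_graphs n H"
    then have "G = \<lparr>pverts = {0..<n}, parcs = parcs G\<rparr>"
      by (simp add: free_graphs_def)
    then show "G \<in> (\<lambda>E. \<lparr>pverts = {0..<n}, parcs = E\<rparr>) ` Pow ({0..<n} \<times> {0..<n})"
      using G by (intro image_eqI[of _ _ "parcs G"]) (auto simp: free_graphs_def pair_graph_iff)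
  qed
qed simp

lemma card_edge_set_le_turan_number:
  "G \<in> free_graphs n H \<Longrightarrow> card (edge_set G) \<le> turan_number n H"
  unfolding turan_number_def by (intro Max_ge) (auto simp: finite_free_graphs)

text \<open>The right-hand side bounds the average degree of the subgraph induced on
  \<open>U\<close>, which is again H-free; some vertex does not exceed the average.\<close>

lemma exists_vertex_degree_le_turan:
  assumes H: "pair_graph H" and G: "G \<in> free_graphs n H" and U: "U \<subseteq> {0..<n}" "U \<noteq> {}"
  shows "\<exists>w\<in>U. real (card {x \<in> U. (w, x) \<in> parcs G}) \<le> 2 * real (turan_number (card U) H) / real (card U)"
proof (rule ccontr)
  define m where "m = card U"
  let ?t = "real (turan_number m H)"
  assume "\<not> ?thesis"
  then have big: "real (card {x \<in> U. (w, x) \<in> parcs G}) > 2 * ?t / real m" if "w \<in> U" for w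
    using that by (auto simp: m_def not_le)
  have finU: "finite U" using U finite_subset by blast
  then have m: "m > 0" using U by (simp add: m_def card_gt_0_iff)
  from G have G': "pair_graph G" "pverts G = {0..<n}" "free_of H G" by (auto simp: free_graphs_def)
  obtain g where g: "bij_betw g {0..<m} U" using ex_bij_betw_nat_finite[OF finU] m_def by blast
  then have ginj: "inj_on g {0..<m}" and gim: "g ` {0..<m} = U" by (auto simp: bij_betw_def)
  \<comment> \<open>\<open>turan_number\<close> speaks of graphs on an initial segment of the
    naturals, so the induced subgraph is relabelled along \<open>g\<close>.\<close>
  define K where "K = \<lparr>pverts = {0..<m}, parcs = {(i, j). i < m \<and> j < m \<and> (g i, g j) \<in> parcs G}\<rparr>"
  have K: "pair_graph K"
    using G'(1) by (auto simp: pair_graph_iff K_def sym_def irrefl_def)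
  have "free_of H K"
  proof (rule ccontr)
    assume "\<not> free_of H K"
    then obtain \<phi> where inj: "inj_on \<phi> (pverts H)" and sub: "\<phi> ` pverts H \<subseteq> {0..<m}"
      and arcs: "\<forall>e\<in>parcs H. (\<phi> (fst e), \<phi> (snd e)) \<in> parcs K"
      unfolding free_of_iff_not_embeds[OF pair_graph_imp_wf[OF H] pair_graph_imp_wf[OF K]] embeds_def
      by (auto simp: K_def)
    have "inj_on (g \<circ> \<phi>) (pverts H)" using inj sub ginj by (intro comp_inj_on) (auto intro: inj_on_subset)
    moreover have "(g \<circ> \<phi>) ` pverts H \<subseteq> pverts G" using sub gim U(1) G'(2) by fastforce
    ultimately have "embeds (with_proj H) (parcs G) (pverts G)"
      unfolding embeds_def using arcs by (intro exI[of _ "g \<circ> \<phi>"]) (auto simp: K_def)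
    with G'(3) free_of_iff_not_embeds[OF pair_graph_imp_wf[OF H] pair_graph_imp_wf[OF G'(1)]]
    show False by blast
  qed
  then have "K \<in> free_graphs m H" using K by (simp add: free_graphs_def K_def)
  then have "card (edge_set K) \<le> turan_number m H" by (rule card_edge_set_le_turan_number)
  moreover have finK: "finite (parcs K)" using K by (auto simp: pair_graph_iff intro: finite_subset)
  ultimately have le: "real (card (parcs K)) \<le> 2 * ?t" using card_parcs_le_edge_set[OF finK] by linarith
  have "parcs K = (SIGMA i:{0..<m}. {j \<in> {0..<m}. (g i, g j) \<in> parcs G})" by (auto simp: K_def)
  then have "card (parcs K) = (\<Sum>i\<in>{0..<m}. card {j \<in> {0..<m}. (g i, g j) \<in> parcs G})"
    by (simp add: card_SigmaI)
  also have "\<dots> = (\<Sum>i\<in>{0..<m}. card {x \<in> U. (g i, x) \<in> parcs G})"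
  proof (rule sum.cong[OF refl])
    fix i
    have "{x \<in> U. (g i, x) \<in> parcs G} = g ` {j \<in> {0..<m}. (g i, g j) \<in> parcs G}" using gim by auto
    moreover have "inj_on g {j \<in> {0..<m}. (g i, g j) \<in> parcs G}" using ginj by (rule inj_on_subset) auto
    ultimately show "card {j \<in> {0..<m}. (g i, g j) \<in> parcs G} = card {x \<in> U. (g i, x) \<in> parcs G}"
      by (simp add: card_image)
  qed
  finally have "real (card (parcs K)) = (\<Sum>i\<in>{0..<m}. real (card {x \<in> U. (g i, x) \<in> parcs G}))" by simp
  also have "\<dots> > (\<Sum>i\<in>{0..<m}. 2 * ?t / real m)"
    using m gim big by (intro sum_strict_mono) auto
  finally show False using le m by simp
qed

text \<open>A part of the neighbourhood with minimum degree at least \<open>h\<close> would contain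
  the tree \<open>H - v\<close>, and \<open>u\<close> would complete it to a copy of
  \<open>H\<close>. Hence the neighbourhood is coloured with \<open>h\<close> colours, and each
  colour class contributes at most 1 by Bessel.\<close>

lemma sum_inner_neighbours_le:
  assumes H: "pair_graph H" "v \<in> pverts H" "card (pverts H) = h"
    and T: "undirected_tree (pre_digraph.del_vert (with_proj H) v)"
    and G: "pair_graph G" "free_of H G"
    and f: "orthonormal_rep G d f" and u: "u \<in> pverts G"
  shows "(\<Sum>w\<in>{w. (u, w) \<in> parcs G}. (f u \<bullet> f w)\<^sup>2) \<le> real h"
proof -
  let ?N = "{w. (u, w) \<in> parcs G}" and ?T = "pre_digraph.del_vert (with_proj H) v"
  have Gs: "finite (pverts G)" "parcs G \<subseteq> pverts G \<times> pverts G" "sym (parcs G)" "irrefl (parcs G)"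
    using G by (auto simp: pair_graph_iff)
  have Hs: "finite (pverts H)" "parcs H \<subseteq> pverts H \<times> pverts H" "sym (parcs H)" "irrefl (parcs H)"
    using H by (auto simp: pair_graph_iff)
  have irr: "(w, w) \<notin> parcs G" for w using Gs(4) by (simp add: irrefl_def)
  have NV: "?N \<subseteq> pverts G" using Gs by auto
  then have finN: "finite ?N" using Gs finite_subset by blast
  have vT: "verts ?T = pverts H - {v}" and aT: "arcs ?T = {e \<in> parcs H. fst e \<noteq> v \<and> snd e \<noteq> v}"
    and tT: "tail ?T = fst" "head ?T = snd"
    by (simp_all add: pre_digraph.del_vert_def)
  have "\<exists>w\<in>U. card {x \<in> U. (w, x) \<in> parcs G} < h" if U: "U \<subseteq> ?N" "U \<noteq> {}" for U
  proof (rule ccontr)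
    assume no: "\<not> ?thesis"
    \<comment> \<open>The tree has \<open>h - 1\<close> vertices, so minimum degree \<open>h\<close>
      is enough for the greedy embedding.\<close>
    have "card (verts ?T) - 1 \<le> h"
      using H Hs by (simp add: vT)
    then have "card (verts ?T) - 1 \<le> card {x \<in> U. (w, x) \<in> parcs G}" if "w \<in> U" for w
      using no that by (meson le_trans not_le)
    then have "embeds ?T (parcs G) U"
      using undirected_tree_embeds[OF T finite_subset[OF U(1) finN] U(2) Gs(3)] irr by blast
    then obtain \<phi> where \<phi>: "inj_on \<phi> (pverts H - {v})" "\<phi> ` (pverts H - {v}) \<subseteq> U"
      "\<And>x y. (x, y) \<in> parcs H \<Longrightarrow> x \<noteq> v \<Longrightarrow> y \<noteq> v \<Longrightarrow> (\<phi> x, \<phi> y) \<in> parcs G"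
      unfolding embeds_def vT aT tT by fastforce
    \<comment> \<open>Since \<open>u\<close> is adjacent to all of \<open>U\<close>, it can play the
      role of \<open>v\<close> whatever the neighbours of \<open>v\<close> in \<open>H\<close>
      are.\<close>
    define \<psi> where "\<psi> = \<phi>(v := u)"
    have uU: "u \<notin> U" using U irr by auto
    have N: "(u, \<phi> x) \<in> parcs G" "(\<phi> x, u) \<in> parcs G" if "x \<in> pverts H" "x \<noteq> v" for x
    proof -
      show "(u, \<phi> x) \<in> parcs G" using \<phi>(2) U(1) that by blast
      then show "(\<phi> x, u) \<in> parcs G" using Gs(3) by (rule symD[rotated])
    qed
    have "inj_on \<psi> (pverts H)"
      using \<phi>(1,2) uU unfolding \<psi>_def inj_on_def by (auto simp: image_subset_iff)
    moreover have "\<psi> ` pverts H \<subseteq> pverts G"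
      using \<phi>(2) U(1) NV u unfolding \<psi>_def by auto
    moreover have "(\<psi> (fst e), \<psi> (snd e)) \<in> parcs G" if e: "e \<in> parcs H" for e
    proof -
      have "fst e \<in> pverts H" "snd e \<in> pverts H" "fst e \<noteq> snd e"
        using e Hs(2,4) by (auto simp: irrefl_def)
      then show ?thesis using \<phi>(3)[of "fst e" "snd e"] N e by (auto simp: \<psi>_def)
    qed
    ultimately have "embeds (with_proj H) (parcs G) (pverts G)" unfolding embeds_def by auto
    with G(2) free_of_iff_not_embeds[OF pair_graph_imp_wf[OF H(1)] pair_graph_imp_wf[OF G(1)]]
    show False by blast
  qed
  from degenerate_colouring[OF finN Gs(3) irr this] obtain \<kappa> :: "_ \<Rightarrow> nat"
    where \<kappa>: "\<forall>x\<in>?N. \<kappa> x < h" "\<forall>x\<in>?N. \<forall>y\<in>?N. (x, y) \<in> parcs G \<longrightarrow> \<kappa> x \<noteq> \<kappa> y" by blast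
  have fV: "f w \<in> carrier_vec d" "f w \<bullet> f w = 1" if "w \<in> pverts G" for w
    using f that by (auto simp: orthonormal_rep_def)
  have "(\<Sum>w\<in>?N. (f u \<bullet> f w)\<^sup>2) = (\<Sum>i\<in>{..<h}. \<Sum>w\<in>{w \<in> ?N. \<kappa> w = i}. (f u \<bullet> f w)\<^sup>2)"
    using \<kappa>(1) finN by (intro sum.group[symmetric]) auto
  also have "\<dots> \<le> (\<Sum>i\<in>{..<h}. f u \<bullet> f u)"
  proof (rule sum_mono)
    fix i
    show "(\<Sum>w\<in>{w \<in> ?N. \<kappa> w = i}. (f u \<bullet> f w)\<^sup>2) \<le> f u \<bullet> f u"
    proof (rule bessel_inequality)
      \<comment> \<open>Neighbours of equal colour are non-adjacent, so their vectors are
        orthogonal.\<close>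
      fix w w' assume w: "w \<in> {w \<in> ?N. \<kappa> w = i}" "w' \<in> {w \<in> ?N. \<kappa> w = i}" "w \<noteq> w'"
      then have "(u, w) \<in> parcs G" "(u, w') \<in> parcs G" "\<kappa> w = \<kappa> w'" by simp_all
      then have "(w, w') \<notin> parcs G" using \<kappa>(2) by blast
      moreover have "w \<in> pverts G" "w' \<in> pverts G" using w NV by auto
      ultimately show "f w \<bullet> f w' = 0" using f w(3) by (simp add: orthonormal_rep_def)
    qed (use finN fV NV u in auto)
  qed
  also have "\<dots> = h" using fV u by simp
  finally show ?thesis .
qed

section \<open>The eigenvalue bound\<close>

text \<open>For an eigenvector \<open>x\<close>, the quadratic form of the Gram matrix equals
  \<open>\<mu>\<close> times the squared norm \<open>s\<close>; the degenerate form bound and the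
  row bound are applied to it and \<open>s\<close> is divided out.\<close>

lemma gram_eigenvalue_le:
  assumes G: "pair_graph G" "pverts G = {0..<n}"
    and f: "orthonormal_rep G d f"
    and h: "h > 0" and row: "\<And>u. u < n \<Longrightarrow> (\<Sum>w\<in>{w. (u, w) \<in> parcs G}. (f u \<bullet> f w)\<^sup>2) \<le> h"
    and D: "D > 0"
    and deg: "\<And>U. U \<subseteq> {0..<n} \<Longrightarrow> U \<noteq> {} \<Longrightarrow> \<exists>w\<in>U. real (card {x \<in> U. (w, x) \<in> parcs G}) \<le> D"
    and ev: "eigenvalue (gram_matrix n f) \<mu>"
  shows "\<mu> \<le> 1 + 2 * sqrt (h * D)"
proof -
  let ?V = "{0..<n}"
  \<comment> \<open>Outside the vertex set \<open>f\<close> is arbitrary, even in its dimension;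
    cutting off by 0 makes \<open>?M\<close> symmetric for all indices.\<close>
  let ?M = "\<lambda>u w. if u < n \<and> w < n then f u \<bullet> f w else 0"
  obtain x where x: "x \<in> carrier_vec n" "x \<noteq> 0\<^sub>v n" "gram_matrix n f *\<^sub>v x = \<mu> \<cdot>\<^sub>v x"
    using ev unfolding eigenvalue_def eigenvector_def by (auto simp: gram_matrix_def)
  have fV: "f w \<in> carrier_vec d" "f w \<bullet> f w = 1" if "w < n" for w
    using f that G(2) by (auto simp: orthonormal_rep_def)
  have zero: "f u \<bullet> f w = 0" if "u < n" "w < n" "u \<noteq> w" "(u, w) \<notin> parcs G" for u w
    using f that G(2) by (auto simp: orthonormal_rep_def)
  have Mx: "(\<Sum>w\<in>?V. (f u \<bullet> f w) * x $ w) = \<mu> * x $ u" if u: "u < n" for u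
  proof -
    have "(gram_matrix n f *\<^sub>v x) $ u = (\<Sum>w\<in>?V. (f u \<bullet> f w) * x $ w)"
      using u carrier_vecD[OF x(1)] by (simp add: gram_matrix_def scalar_prod_def)
    then show ?thesis using u carrier_vecD[OF x(1)] by (simp add: x(3))
  qed
  define s where "s = (\<Sum>u\<in>?V. (x $ u)\<^sup>2)"
  have s: "s > 0"
  proof -
    obtain i where "i < n" "x $ i \<noteq> 0" using x(1,2) by (metis eq_vecI index_zero_vec carrier_vecD)
    then show ?thesis unfolding s_def by (intro sum_pos2[of _ i]) auto
  qed
  \<comment> \<open>this \<open>t\<close> balances \<open>t * D\<close> against \<open>h / t\<close>\<close>
  define t where "t = sqrt (h / D)"
  have t: "t > 0" using h D by (simp add: t_def)
  have "\<mu> * s = (\<Sum>u\<in>?V. x $ u * (\<Sum>w\<in>?V. (f u \<bullet> f w) * x $ w))"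
    unfolding s_def sum_distrib_left[of \<mu>] using Mx by (intro sum.cong refl) (simp add: power2_eq_square)
  also have "\<dots> = (\<Sum>u\<in>?V. \<Sum>w\<in>?V. ?M u w * x $ u * x $ w)"
    unfolding sum_distrib_left by (intro sum.cong refl) simp
  also have "\<dots> \<le> (1 + t * D) * s + (\<Sum>u\<in>?V. \<Sum>w\<in>?V. if u = w then 0 else (x $ u)\<^sup>2 * (?M u w)\<^sup>2) / t"
    unfolding s_def
  proof (rule degenerate_quadratic_form_bound[where E = "parcs G"])
    show "?M u w = ?M w u" for u w using comm_scalar_prod[OF fV(1) fV(1)] by auto
  qed (use t D fV zero deg in auto)
  also have "(\<Sum>u\<in>?V. \<Sum>w\<in>?V. if u = w then 0 else (x $ u)\<^sup>2 * (?M u w)\<^sup>2) \<le> (\<Sum>u\<in>?V. h * (x $ u)\<^sup>2)"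
  proof (rule sum_mono)
    fix u assume u: "u \<in> ?V"
    let ?N = "{w. (u, w) \<in> parcs G}"
    have N: "?N \<subseteq> ?V" "u \<notin> ?N" using G by (auto simp: pair_graph_iff irrefl_def)
    \<comment> \<open>Off-diagonal entries vanish outside the neighbourhood of \<open>u\<close>,
      which leaves exactly the sum controlled by \<open>row\<close>.\<close>
    have "(\<Sum>w\<in>?V. if u = w then 0 else (x $ u)\<^sup>2 * (?M u w)\<^sup>2) =
        (\<Sum>w\<in>?N. if u = w then 0 else (x $ u)\<^sup>2 * (?M u w)\<^sup>2)"
      using N u zero[of u] by (intro sum.mono_neutral_right) auto
    also have "\<dots> = (x $ u)\<^sup>2 * (\<Sum>w\<in>?N. (f u \<bullet> f w)\<^sup>2)"
      unfolding sum_distrib_left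
    proof (rule sum.cong[OF refl])
      fix w assume "w \<in> ?N"
      then have "w < n" "u \<noteq> w" using N by auto
      then show "(if u = w then 0 else (x $ u)\<^sup>2 * (?M u w)\<^sup>2) = (x $ u)\<^sup>2 * (f u \<bullet> f w)\<^sup>2"
        using u by simp
    qed
    also have "\<dots> \<le> (x $ u)\<^sup>2 * h" using row[of u] u by (intro mult_left_mono) auto
    finally show "(\<Sum>w\<in>?V. if u = w then 0 else (x $ u)\<^sup>2 * (?M u w)\<^sup>2) \<le> h * (x $ u)\<^sup>2"
      by (simp add: mult.commute)
  qed
  also have "(\<Sum>u\<in>?V. h * (x $ u)\<^sup>2) = h * s" by (simp add: s_def sum_distrib_left)
  finally have "\<mu> * s \<le> (1 + t * D) * s + h * s / t" using t by (simp add: divide_right_mono)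
  also have "\<dots> = (1 + (t * D + h / t)) * s" using t by (simp add: field_simps)
  finally have "\<mu> \<le> 1 + (t * D + h / t)" using s by simp
  moreover have "t * D = sqrt (h * D)"
    using h D by (simp add: t_def real_sqrt_divide real_sqrt_mult real_div_sqrt field_simps)
  moreover have "h / t = sqrt (h * D)"
    using h D by (simp add: t_def real_sqrt_divide real_sqrt_mult real_div_sqrt field_simps)
  ultimately show ?thesis by simp
qed

section \<open>From Gram eigenvalues to the theta function\<close>

lemma complement_complement: "pair_graph G \<Longrightarrow> complement (complement G) = G"
  by (cases G) (auto simp: complement_def pair_graph_iff irrefl_def)

text \<open>The two complements cancel, so the supremum ranges over the orthonormal representations
  of \<open>G\<close> itself.\<close>

lemma lovasz_theta_complement_le:
  assumes G: "pair_graph G" "pverts G = {0..<n}" and n: "n \<ge> 1"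
    and bound: "\<And>d f \<mu>. orthonormal_rep G d f \<Longrightarrow> eigenvalue (gram_matrix n f) \<mu> \<Longrightarrow> \<mu> \<le> B"
  shows "lovasz_theta (complement G) \<le> B"
proof -
  have card: "card (pverts (complement G)) = n" using G(2) by (simp add: complement_def)
  \<comment> \<open>The standard basis represents every graph on these vertices; it shows that the
    supremum is over a nonempty set.\<close>
  have "orthonormal_rep G n (unit_vec n)"
    using G(2) by (auto simp: orthonormal_rep_def)
  moreover have "Max (spectrum (gram_matrix n f)) \<le> B" if f: "orthonormal_rep G d f" for d f
  proof -
    have A: "gram_matrix n f \<in> carrier_mat n n" by (simp add: gram_matrix_def)
    \<comment> \<open>otherwise \<open>Max\<close> would be unspecified\<close>
    have "spectrum (gram_matrix n f) \<noteq> {}"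
    proof (rule symmetric_real_spectrum_nonempty[OF A])
      fix i j assume ij: "i < n" "j < n"
      then have "f i \<in> carrier_vec d" "f j \<in> carrier_vec d"
        using f G(2) by (auto simp: orthonormal_rep_def)
      then show "gram_matrix n f $$ (i, j) = gram_matrix n f $$ (j, i)"
        using ij comm_scalar_prod by (auto simp: gram_matrix_def)
    qed (use n in simp)
    then show ?thesis using card_finite_spectrum(1)[OF A] bound[OF f]
      by (simp add: spectrum_def)
  qed
  ultimately show ?thesis
    unfolding lovasz_theta_def complement_complement[OF G(1)] card
    by (intro cSup_least) auto
qed

text \<open>The edgeless graph is a member. \<open>Max\<close> over an empty family would be
  unspecified.\<close>

lemma free_graphs_nonempty:
  assumes H: "pair_graph H" "e \<in> parcs H"
  shows "free_graphs n H \<noteq> {}"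
proof -
  let ?G = "\<lparr>pverts = {0..<n}, parcs = {}\<rparr> :: nat pair_pre_digraph"
  have "pair_graph ?G" by (simp add: pair_graph_iff sym_def irrefl_def)
  moreover from this have "free_of H ?G"
    using free_of_iff_not_embeds[OF pair_graph_imp_wf[OF H(1)] pair_graph_imp_wf, of ?G] H(2)
    by (cases e) (auto simp: embeds_def)
  ultimately have "?G \<in> free_graphs n H" by (simp add: free_graphs_def)
  then show ?thesis by blast
qed

lemma connected_imp_exists_arc:
  assumes "Digraph_Component.connected G" "u \<in> verts G" "v \<in> verts G" "u \<noteq> v"
  shows "arcs G \<noteq> {}"
proof
  assume "arcs G = {}"
  then have "parcs (mk_symmetric G) = {}" by (simp add: parcs_mk_symmetric)
  moreover have "(u, v) \<in> rtrancl_on (verts G) (parcs (mk_symmetric G))"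
    using assms unfolding connected_def strongly_connected_def reachable_def by simp
  ultimately have "(u, v) \<in> rtrancl_on (verts G) {}" by simp
  then show False using assms(4) by (cases rule: rtrancl_on.cases) auto
qed

theorem theorem1p5:
  fixes H :: "'a pair_pre_digraph" and v :: 'a and h :: nat and c \<alpha> :: real
  assumes "h \<ge> 1"
    and "pair_graph H"
    and "card (pverts H) = h"
    and "Digraph_Component.connected (with_proj H)"
    and "v \<in> pverts H"
    and "undirected_tree (pre_digraph.del_vert (with_proj H) v)"
    and "c \<ge> 1"
    and "0 < \<alpha>" and "\<alpha> \<le> 1"
    and "\<forall>n::nat. n \<ge> 1 \<longrightarrow> real (turan_number n H) \<le> c * real n powr (1 + \<alpha>)"
  shows "\<forall>n::nat. n \<ge> 1 \<longrightarrow>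
    lambda_free n H \<le> 20 * (sqrt (c * real h) / \<alpha>) * real n powr (\<alpha> / 2)"
proof (intro allI impI)
  fix n :: nat
  assume n: "n \<ge> 1"
  note H = assms(2) and T = assms(6)
  let ?D = "2 * c * real n powr \<alpha>" and ?X = "sqrt (c * real h) * real n powr (\<alpha> / 2)"
  \<comment> \<open>A tree is nonempty, so \<open>H\<close> has a vertex besides \<open>v\<close>,
    and connectedness then yields an arc. It ensures that the family of H-free graphs is
    nonempty.\<close>
  obtain w where "w \<in> pverts H" "w \<noteq> v"
    using T unfolding undirected_tree_def connected_def strongly_connected_def
    by (auto simp: pre_digraph.del_vert_def)
  then obtain e where e: "e \<in> parcs H"
    using connected_imp_exists_arc[OF assms(4), of v w] assms(5) by auto
  have theta: "lovasz_theta (complement G) \<le> 1 + 2 * sqrt (real h * ?D)" if G: "G \<in> free_graphs n H" for G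
  proof -
    have G': "pair_graph G" "pverts G = {0..<n}" "free_of H G" using G by (auto simp: free_graphs_def)
    have deg: "\<exists>w\<in>U. real (card {x \<in> U. (w, x) \<in> parcs G}) \<le> ?D" if U: "U \<subseteq> {0..<n}" "U \<noteq> {}" for U
    proof -
      have "finite U" using U(1) finite_subset by blast
      then have m: "card U \<ge> 1" "card U \<le> n"
        using U card_mono[OF _ U(1)] by (auto simp: Suc_le_eq card_gt_0_iff)
      \<comment> \<open>With \<open>m = card U\<close>, the Turan hypothesis bounds the average
        degree by \<open>2 * c * m powr \<alpha>\<close>, which is monotone in \<open>m\<close> and
        so largest at \<open>m = n\<close>.\<close>
      have "2 * real (turan_number (card U) H) / real (card U) \<le> 2 * (c * real (card U) powr (1 + \<alpha>)) / real (card U)"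
        using assms(10) m(1) by (intro divide_right_mono mult_left_mono) auto
      also have "\<dots> = 2 * c * real (card U) powr \<alpha>" using m(1) by (simp add: powr_add)
      also have "\<dots> \<le> ?D" using m assms by (intro mult_left_mono powr_mono2) auto
      finally show ?thesis using exists_vertex_degree_le_turan[OF H G U] by (meson order_trans)
    qed
    show ?thesis
    proof (rule lovasz_theta_complement_le[OF G'(1,2) n])
      fix d f \<mu> assume f: "orthonormal_rep G d f" and ev: "eigenvalue (gram_matrix n f) \<mu>"
      have row: "(\<Sum>w\<in>{w. (u, w) \<in> parcs G}. (f u \<bullet> f w)\<^sup>2) \<le> real h" if "u < n" for u
        using sum_inner_neighbours_le[OF H assms(5,3) T G'(1,3) f] that G'(2) by simp
      show "\<mu> \<le> 1 + 2 * sqrt (real h * ?D)"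
        by (rule gram_eigenvalue_le[OF G'(1,2) f _ row _ deg ev]) (use assms n in auto)
    qed
  qed
  \<comment> \<open>This lets the additive 1, coming from the diagonal of the Gram matrix, be
    absorbed into a multiple of \<open>?X\<close>.\<close>
  have X: "1 \<le> ?X"
  proof -
    have "1 * 1 \<le> c * real h" using assms by (intro mult_mono) auto
    then have "1 \<le> sqrt (c * real h)" by simp
    moreover have "1 \<le> real n powr (\<alpha> / 2)" using n assms by (intro ge_one_powr_ge_zero) auto
    ultimately have "1 * 1 \<le> ?X" by (intro mult_mono) auto
    then show ?thesis by simp
  qed
  have "sqrt (real h * ?D) = sqrt 2 * ?X"
  proof -
    have "sqrt (real n powr \<alpha>) = real n powr (\<alpha> / 2)"
      using n by (simp add: powr_half_sqrt[symmetric] powr_powr)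
    then show ?thesis by (simp add: real_sqrt_mult mult_ac)
  qed
  \<comment> \<open>With this crude estimate the bound is at most \<open>1 + 4 * ?X\<close>, hence
    at most \<open>5 * ?X\<close>, well within the factor 20.\<close>
  moreover have "sqrt 2 * ?X \<le> 2 * ?X"
    using X by (intro mult_right_mono) (auto intro: real_le_lsqrt)
  ultimately have "1 + 2 * sqrt (real h * ?D) \<le> 20 * ?X" using X by linarith
  \<comment> \<open>Dividing by a positive \<open>\<alpha>\<close> of at most 1 does not decrease a
    nonnegative quantity.\<close>
  also have "\<dots> \<le> 20 * ?X / \<alpha>"
    using X assms(8,9) by (simp add: le_divide_eq mult_left_le)
  also have "\<dots> = 20 * (sqrt (c * real h) / \<alpha>) * real n powr (\<alpha> / 2)" by simp
  finally have "lovasz_theta (complement G) \<le> 20 * (sqrt (c * real h) / \<alpha>) * real n powr (\<alpha> / 2)"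
    if "G \<in> free_graphs n H" for G
    using theta[OF that] by linarith
  then show "lambda_free n H \<le> 20 * (sqrt (c * real h) / \<alpha>) * real n powr (\<alpha> / 2)"
    unfolding lambda_free_def using free_graphs_nonempty[OF H e, of n] finite_free_graphs[of n H]
    by (intro Max.boundedI) auto
qed

end
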